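(* Let $\mathcal{U}$ be an ultrafilter on $\mathbb{N}$ such that for every $b\in\mathbb{N}$ the set $\{n\in\mathbb{N}: n \text{ has at least } b \text{ distinct prime divisors}\}$ belongs to $\mathcal{U}$. Then the ultraproduct ring $\prod_{n\in\mathbb{N}}\mathbb{Z}/n\mathbb{Z}\,/\,\mathcal{U}$ has TP2 theory (i.e. is not NTP2).
   Context: Rings are considered as structures in the language of rings. A formula $\varphi(x,y)$ has the tree property of the second kind (TP2) in a theory $T$ if there are parameters $\{b_{i,j}:i,j<\omega\}$ in a model of $T$ and $l<\omega$ such that (i) for every $i$, $\{\varphi(x,b_{i,j}):j<\omega\}$ is $l$-inconsistent, and (ii) for every $\xi\in\omega^\omega$, $\{\varphi(x,b_{i,\xi(i)}):i<\omega\}$ is consistent. A theory has TP2 if some formula has TP2. *)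

theory Defs
  imports "HOL-Algebra.IntRing" "HOL-Computational_Algebra.Primes"
begin

section \<open>First-order logic in the language of rings\<close>

datatype rterm =
    RVar nat
  | RZero
  | ROne
  | RAdd rterm rterm
  | RNeg rterm
  | RMul rterm rterm

datatype rform =
    FEq rterm rterm
  | FNot rform
  | FAnd rform rform
  | FEx nat rform

primrec term_vars :: "rterm \<Rightarrow> nat set" where
  "term_vars (RVar x) = {x}"
| "term_vars RZero = {}"
| "term_vars ROne = {}"
| "term_vars (RAdd s t) = term_vars s \<union> term_vars t"
| "term_vars (RNeg t) = term_vars t"
| "term_vars (RMul s t) = term_vars s \<union> term_vars t"

primrec free_vars :: "rform \<Rightarrow> nat set" where
  "free_vars (FEq s t) = term_vars s \<union> term_vars t"
| "free_vars (FNot \<phi>) = free_vars \<phi>"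
| "free_vars (FAnd \<phi> \<psi>) = free_vars \<phi> \<union> free_vars \<psi>"
| "free_vars (FEx x \<phi>) = free_vars \<phi> - {x}"

primrec term_val :: "('a, 'b) ring_scheme \<Rightarrow> (nat \<Rightarrow> 'a) \<Rightarrow> rterm \<Rightarrow> 'a" where
  "term_val R v (RVar x) = v x"
| "term_val R v RZero = \<zero>\<^bsub>R\<^esub>"
| "term_val R v ROne = \<one>\<^bsub>R\<^esub>"
| "term_val R v (RAdd s t) = term_val R v s \<oplus>\<^bsub>R\<^esub> term_val R v t"
| "term_val R v (RNeg t) = \<ominus>\<^bsub>R\<^esub> term_val R v t"
| "term_val R v (RMul s t) = term_val R v s \<otimes>\<^bsub>R\<^esub> term_val R v t"

primrec sat :: "('a, 'b) ring_scheme \<Rightarrow> (nat \<Rightarrow> 'a) \<Rightarrow> rform \<Rightarrow> bool" where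
  "sat R v (FEq s t) \<longleftrightarrow> term_val R v s = term_val R v t"
| "sat R v (FNot \<phi>) \<longleftrightarrow> \<not> sat R v \<phi>"
| "sat R v (FAnd \<phi> \<psi>) \<longleftrightarrow> sat R v \<phi> \<and> sat R v \<psi>"
| "sat R v (FEx x \<phi>) \<longleftrightarrow> (\<exists>a\<in>carrier R. sat R (v(x := a)) \<phi>)"

definition sentence :: "rform \<Rightarrow> bool" where
  "sentence \<phi> \<longleftrightarrow> free_vars \<phi> = {}"

definition ring_theory :: "('a, 'b) ring_scheme \<Rightarrow> rform set" where
  "ring_theory R = {\<phi>. sentence \<phi> \<and> (\<forall>v. range v \<subseteq> carrier R \<longrightarrow> sat R v \<phi>)}"

definition is_model :: "('a, 'b) ring_scheme \<Rightarrow> rform set \<Rightarrow> bool" where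
  "is_model M T \<longleftrightarrow> ring M \<and> T \<subseteq> ring_theory M"

definition elementary_embedding ::
    "('a \<Rightarrow> 'c) \<Rightarrow> ('a, 'b) ring_scheme \<Rightarrow> ('c, 'd) ring_scheme \<Rightarrow> bool" where
  "elementary_embedding h M N \<longleftrightarrow>
     h ` carrier M \<subseteq> carrier N \<and>
     (\<forall>\<phi> v. range v \<subseteq> carrier M \<longrightarrow> (sat M v \<phi> \<longleftrightarrow> sat N (h \<circ> v) \<phi>))"

section \<open>The tree property of the second kind\<close>

text \<open>
  A formula \<open>\<phi>(x,y)\<close> with tuples \<open>x\<close> of length \<open>k\<close> and \<open>y\<close> of length \<open>m\<close> is a formula whose
  free variables are below \<open>k + m\<close>: the variables below \<open>k\<close> form \<open>x\<close>, the next \<open>m\<close> ones form \<open>y\<close>.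
  The value outside the tuple is never consulted for such a formula.
\<close>

definition assign :: "('a, 'b) ring_scheme \<Rightarrow> 'a list \<Rightarrow> nat \<Rightarrow> 'a" where
  "assign R as i = (if i < length as then as ! i else \<zero>\<^bsub>R\<^esub>)"

text \<open>
  A set of formulas in the tuple \<open>x\<close> of length \<open>k\<close> with parameters in \<open>M\<close> is given as a set of
  pairs of a formula \<open>\<phi>(x,y)\<close> and a tuple of parameters substituted for \<open>y\<close>. It is consistent
  if it is realised in some elementary extension of \<open>M\<close>. Elementary extensions are taken up to
  isomorphism, hence the embedding \<open>h\<close>. For countable sets of formulas and an infinite type \<open>'a\<close>
  it is no restriction that the extension lives on the same type as \<open>M\<close>: by the downward
  Loewenheim-Skolem theorem it can be chosen of cardinality at most that of \<open>M\<close> plus aleph-zero.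
\<close>

definition consistent :: "nat \<Rightarrow> 'a ring \<Rightarrow> (rform \<times> 'a list) set \<Rightarrow> bool" where
  "consistent k M \<Gamma> \<longleftrightarrow>
     (\<exists>(N :: 'a ring) h as. ring N \<and> elementary_embedding h M N \<and>
        length as = k \<and> set as \<subseteq> carrier N \<and>
        (\<forall>(\<phi>, bs)\<in>\<Gamma>. sat N (assign N (as @ map h bs)) \<phi>))"

text \<open>
  HOL cannot quantify over types, so the type on which the models of \<open>T\<close> live is an argument.
  By the downward Loewenheim-Skolem theorem all infinite types give the same notion, because the
  language and the array of parameters are countable.

  The \<open>l\<close>-inconsistency is that of the indexed family: any \<open>l\<close> distinct indices give an
  inconsistent set. Reading it for the underlying set would make a row of equal
  parameters vacuously 2-inconsistent.
\<close>

definition formula_TP2 :: "'a itself \<Rightarrow> rform set \<Rightarrow> nat \<Rightarrow> nat \<Rightarrow> rform \<Rightarrow> bool" where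
  "formula_TP2 (_ :: 'a itself) T k m \<phi> \<longleftrightarrow>
     (\<exists>(M :: 'a ring) (b :: nat \<Rightarrow> nat \<Rightarrow> 'a list) (l :: nat).
        is_model M T \<and>
        (\<forall>i j. length (b i j) = m \<and> set (b i j) \<subseteq> carrier M) \<and>
        (\<forall>i J. finite J \<and> card J = l \<longrightarrow> \<not> consistent k M {(\<phi>, b i j) | j. j \<in> J}) \<and>
        (\<forall>\<xi> :: nat \<Rightarrow> nat. consistent k M {(\<phi>, b i (\<xi> i)) | i. True}))"

definition theory_TP2 :: "'a itself \<Rightarrow> rform set \<Rightarrow> bool" where
  "theory_TP2 ty T \<longleftrightarrow>
     (\<exists>k m \<phi>. free_vars \<phi> \<subseteq> {..<k + m} \<and> formula_TP2 ty T k m \<phi>)"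

section \<open>Ultraproducts of rings\<close>

definition ultrafilter :: "'i filter \<Rightarrow> bool" where
  "ultrafilter F \<longleftrightarrow> F \<noteq> bot \<and> (\<forall>P. eventually P F \<or> eventually (\<lambda>i. \<not> P i) F)"

definition ultra_rel ::
    "'i filter \<Rightarrow> ('i \<Rightarrow> ('a, 'b) ring_scheme) \<Rightarrow> (('i \<Rightarrow> 'a) \<times> ('i \<Rightarrow> 'a)) set" where
  "ultra_rel F R = {(f, g). f \<in> (\<Pi> i\<in>UNIV. carrier (R i)) \<and> g \<in> (\<Pi> i\<in>UNIV. carrier (R i)) \<and>
                            eventually (\<lambda>i. f i = g i) F}"

definition ultraproduct ::
    "'i filter \<Rightarrow> ('i \<Rightarrow> ('a, 'b) ring_scheme) \<Rightarrow> ('i \<Rightarrow> 'a) set ring" where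
  "ultraproduct F R =
     \<lparr>carrier = (\<Pi> i\<in>UNIV. carrier (R i)) // ultra_rel F R,
      mult = (\<lambda>A B. \<Union>f\<in>A. \<Union>g\<in>B. ultra_rel F R `` {\<lambda>i. f i \<otimes>\<^bsub>R i\<^esub> g i}),
      one = ultra_rel F R `` {\<lambda>i. \<one>\<^bsub>R i\<^esub>},
      zero = ultra_rel F R `` {\<lambda>i. \<zero>\<^bsub>R i\<^esub>},
      add = (\<lambda>A B. \<Union>f\<in>A. \<Union>g\<in>B. ultra_rel F R `` {\<lambda>i. f i \<oplus>\<^bsub>R i\<^esub> g i})\<rparr>"

end

theory Submission
  imports Defs "HOL-Number_Theory.Cong"
begin

text \<open>
  The formula \<open>y\<^sub>1 | x - y\<^sub>2\<close> has TP2. If \<open>n\<close> has at least \<open>2k\<close> prime divisors, then \<open>k\<close> of them, say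
  \<open>p\<^sub>0(n), \<dots>, p\<^bsub>k-1\<^esub>(n)\<close>, are at least \<open>k\<close>. The parameters of row \<open>i\<close> and column \<open>j\<close> are
  \<open>y\<^sub>1 = p\<^sub>i(n)\<close> and \<open>y\<^sub>2 = j\<close>: the residues \<open>j < k\<close> are distinct modulo \<open>p\<^sub>i(n)\<close>, so rows are
  2-inconsistent, while the Chinese remainder theorem solves the congruences of a branch at each \<open>n\<close>.
  As \<open>k = k(n)\<close> tends to infinity along the ultrafilter, Los's theorem carries both facts
  to the ultraproduct, where even the infinite branches are realised.
\<close>

section \<open>Refining a proper filter to an ultrafilter\<close>

text \<open>Zorn's lemma for the reversed order gives a minimal proper filter below
  \<open>F\<close>, and minimality forces it to decide every predicate. Applied to
  \<open>sequentially\<close>, this supplies the free ultrafilter for the case where the given one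
  is principal.\<close>

lemma ultrafilter_le_exists:
  fixes F :: "'i filter"
  assumes "F \<noteq> bot"
  shows "\<exists>V\<le>F. ultrafilter V"
proof -
  define A where "A = {G. G \<noteq> bot \<and> G \<le> F}"
  have "\<exists>V\<in>A. \<forall>G\<in>A. V \<ge> G \<longrightarrow> G = V"
  proof (rule predicate_Zorn)
    show "partial_order_on A (relation_of (\<ge>) A)"
      by (rule partial_order_on_relation_ofI) auto
  next
    fix C assume C: "C \<in> Chains (relation_of (\<ge>) A)"
    have total: "x \<le> y \<or> y \<le> x" and sub: "x \<in> A" if "x \<in> C" "y \<in> C" for x y
      using C that by (auto simp: Chains_def relation_of_def)
    show "\<exists>G\<in>A. \<forall>H\<in>C. H \<ge> G"
    proof (cases "C = {}")
      case True
      then show ?thesis using assms by (auto simp: A_def)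
    next
      case False
      \<comment> \<open>A nonempty chain is a filter base for its infimum, so the infimum could be
        trivial only if some member were.\<close>
      have "eventually (\<lambda>_. False) (Inf C) \<longleftrightarrow> (\<exists>H\<in>C. eventually (\<lambda>_. False) H)"
      proof (rule eventually_Inf_base[OF False])
        fix G H assume "G \<in> C" "H \<in> C"
        then show "\<exists>x\<in>C. x \<le> inf G H"
          using total[of G H] by (auto intro: bexI[of _ G] bexI[of _ H])
      qed
      then have "Inf C \<noteq> bot"
        using sub by (auto simp: trivial_limit_def A_def)
      moreover obtain H where "H \<in> C" using False by blast
      then have "Inf C \<le> F"
        using sub by (intro Inf_lower2[of H]) (auto simp: A_def)
      ultimately show ?thesis
        by (intro bexI[of _ "Inf C"]) (auto simp: A_def intro: Inf_lower)
    qed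
  qed
  then obtain V where V: "V \<noteq> bot" "V \<le> F"
    and max: "\<And>G. G \<noteq> bot \<Longrightarrow> G \<le> V \<Longrightarrow> G = V"
    unfolding A_def by (blast intro: order_trans)
  have "eventually P V \<or> eventually (\<lambda>i. \<not> P i) V" for P
  \<comment> \<open>Cutting \<open>V\<close> down to \<open>P\<close> yields either
    \<open>bot\<close>, and then \<open>V\<close> contains the complement of \<open>P\<close>, or by
    minimality \<open>V\<close> itself, and then \<open>V\<close> contains \<open>P\<close>.\<close>
  proof (cases "inf V (principal {i. P i}) = bot")
    case True
    then show ?thesis
      by (simp add: trivial_limit_def eventually_inf_principal)
  next
    case False
    then have "inf V (principal {i. P i}) = V"
      by (rule max) simp
    then have "V \<le> principal {i. P i}"
      by (metis inf.cobounded2)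
    then show ?thesis by (simp add: le_principal)
  qed
  with V show ?thesis by (auto simp: ultrafilter_def)
qed

lemma ultrafilter_eventually_not:
  "ultrafilter F \<Longrightarrow> eventually (\<lambda>i. \<not> P i) F \<longleftrightarrow> \<not> eventually P F"
  by (auto simp: ultrafilter_def trivial_limit_def dest: eventually_conj)

section \<open>Ultraproducts\<close>

abbreviation ultra_class ::
    "'i filter \<Rightarrow> ('i \<Rightarrow> ('a, 'b) ring_scheme) \<Rightarrow> ('i \<Rightarrow> 'a) \<Rightarrow> ('i \<Rightarrow> 'a) set" where
  "ultra_class F R f \<equiv> ultra_rel F R `` {f}"

text \<open>The ring structure is that of a reduced product modulo a filter; the ultrafilter
  property enters with negation in Los's theorem.\<close>

locale ring_family =
  fixes F :: "'i filter" and R :: "'i \<Rightarrow> ('a, 'b) ring_scheme"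
  assumes ring_component: "\<And>i. ring (R i)"
begin

abbreviation prod_carrier :: "('i \<Rightarrow> 'a) set" where
  "prod_carrier \<equiv> (\<Pi> i\<in>UNIV. carrier (R i))"

lemma equiv_ultra_rel: "equiv prod_carrier (ultra_rel F R)"
proof (rule equivI)
  show "sym (ultra_rel F R)"
    by (auto simp: sym_def ultra_rel_def elim: eventually_mono)
  show "trans (ultra_rel F R)"
    by (auto simp: trans_def ultra_rel_def elim: eventually_elim2)
qed (auto simp: refl_on_def ultra_rel_def)

lemma ultra_class_eq_iff:
  "f \<in> prod_carrier \<Longrightarrow> g \<in> prod_carrier \<Longrightarrow>
     ultra_class F R f = ultra_class F R g \<longleftrightarrow> eventually (\<lambda>i. f i = g i) F"
  using eq_equiv_class_iff[OF equiv_ultra_rel, of f g] by (auto simp: ultra_rel_def)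

lemma carrier_ultraproduct: "carrier (ultraproduct F R) = ultra_class F R ` prod_carrier"
  by (auto simp: ultraproduct_def quotient_def)

lemma ultra_class_closed:
  "f \<in> prod_carrier \<Longrightarrow> ultra_class F R f \<in> carrier (ultraproduct F R)"
  by (simp add: carrier_ultraproduct)

lemma zero_ultraproduct: "\<zero>\<^bsub>ultraproduct F R\<^esub> = ultra_class F R (\<lambda>i. \<zero>\<^bsub>R i\<^esub>)"
  and one_ultraproduct: "\<one>\<^bsub>ultraproduct F R\<^esub> = ultra_class F R (\<lambda>i. \<one>\<^bsub>R i\<^esub>)"
  by (simp_all add: ultraproduct_def)

lemma
  shows add_prod_closed: "f \<in> prod_carrier \<Longrightarrow> g \<in> prod_carrier \<Longrightarrow> (\<lambda>i. f i \<oplus>\<^bsub>R i\<^esub> g i) \<in> prod_carrier"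
    and mult_prod_closed: "f \<in> prod_carrier \<Longrightarrow> g \<in> prod_carrier \<Longrightarrow> (\<lambda>i. f i \<otimes>\<^bsub>R i\<^esub> g i) \<in> prod_carrier"
    and neg_prod_closed: "f \<in> prod_carrier \<Longrightarrow> (\<lambda>i. \<ominus>\<^bsub>R i\<^esub> f i) \<in> prod_carrier"
    and zero_prod_closed: "(\<lambda>i. \<zero>\<^bsub>R i\<^esub>) \<in> prod_carrier"
    and one_prod_closed: "(\<lambda>i. \<one>\<^bsub>R i\<^esub>) \<in> prod_carrier"
  using ring_component
  by (auto simp: Pi_iff ring.ring_simprules)

lemmas prod_closed =
  add_prod_closed mult_prod_closed neg_prod_closed zero_prod_closed one_prod_closed

text \<open>Two eventual equalities hold simultaneously on a set of the filter, so pointwise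
  operations respect classes. This evaluates the unions over representatives by which
  \<open>ultraproduct\<close> defines addition and multiplication.\<close>

lemma congruent2_ultra_class:
  assumes "\<And>f g. f \<in> prod_carrier \<Longrightarrow> g \<in> prod_carrier \<Longrightarrow> (\<lambda>i. h i (f i) (g i)) \<in> prod_carrier"
  shows "congruent2 (ultra_rel F R) (ultra_rel F R) (\<lambda>f g. ultra_class F R (\<lambda>i. h i (f i) (g i)))"
  unfolding congruent2_def
proof clarify
  fix f f' g g' assume "(f, f') \<in> ultra_rel F R" "(g, g') \<in> ultra_rel F R"
  then have mem: "f \<in> prod_carrier" "f' \<in> prod_carrier" "g \<in> prod_carrier" "g' \<in> prod_carrier"
    and ev: "eventually (\<lambda>i. f i = f' i) F" "eventually (\<lambda>i. g i = g' i) F"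
    by (simp_all only: ultra_rel_def mem_Collect_eq case_prod_conv)
  from ev have "eventually (\<lambda>i. h i (f i) (g i) = h i (f' i) (g' i)) F"
    by (rule eventually_elim2) simp
  then show "ultra_class F R (\<lambda>i. h i (f i) (g i)) = ultra_class F R (\<lambda>i. h i (f' i) (g' i))"
    by (subst ultra_class_eq_iff) (use assms mem in blast)+
qed

lemma add_ultraproduct:
  assumes "f \<in> prod_carrier" "g \<in> prod_carrier"
  shows "ultra_class F R f \<oplus>\<^bsub>ultraproduct F R\<^esub> ultra_class F R g
         = ultra_class F R (\<lambda>i. f i \<oplus>\<^bsub>R i\<^esub> g i)"
  using UN_equiv_class2[OF equiv_ultra_rel equiv_ultra_rel
      congruent2_ultra_class[OF add_prod_closed] assms]
  by (simp add: ultraproduct_def)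

lemma mult_ultraproduct:
  assumes "f \<in> prod_carrier" "g \<in> prod_carrier"
  shows "ultra_class F R f \<otimes>\<^bsub>ultraproduct F R\<^esub> ultra_class F R g
         = ultra_class F R (\<lambda>i. f i \<otimes>\<^bsub>R i\<^esub> g i)"
  using UN_equiv_class2[OF equiv_ultra_rel equiv_ultra_rel
      congruent2_ultra_class[OF mult_prod_closed] assms]
  by (simp add: ultraproduct_def)

lemma ultraproduct_cases:
  assumes "x \<in> carrier (ultraproduct F R)"
  obtains f where "\<forall>i. f i \<in> carrier (R i)" "x = ultra_class F R f"
  using assms by (auto simp: carrier_ultraproduct)

lemma ring_ultraproduct: "ring (ultraproduct F R)"
proof (rule ringI)
  note simps = zero_ultraproduct one_ultraproduct add_ultraproduct mult_ultraproduct Pi_iff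
    ultra_class_closed ring.ring_simprules[OF ring_component]
    monoid.r_one[OF ring.is_monoid[OF ring_component]]
  show "abelian_group (ultraproduct F R)"
  proof (rule abelian_groupI)
    fix x assume "x \<in> carrier (ultraproduct F R)"
    then obtain f where "\<forall>i. f i \<in> carrier (R i)" "x = ultra_class F R f"
      by (rule ultraproduct_cases)
    then show "\<exists>y\<in>carrier (ultraproduct F R). y \<oplus>\<^bsub>ultraproduct F R\<^esub> x = \<zero>\<^bsub>ultraproduct F R\<^esub>"
      by (intro bexI[of _ "ultra_class F R (\<lambda>i. \<ominus>\<^bsub>R i\<^esub> f i)"]) (simp_all add: simps)
  qed ((elim ultraproduct_cases)?; simp add: simps)+
  show "Group.monoid (ultraproduct F R)"
    by (rule monoidI; (elim ultraproduct_cases)?; simp add: simps)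
  fix x y z
  assume "x \<in> carrier (ultraproduct F R)" "y \<in> carrier (ultraproduct F R)"
    "z \<in> carrier (ultraproduct F R)"
  then show "(x \<oplus>\<^bsub>ultraproduct F R\<^esub> y) \<otimes>\<^bsub>ultraproduct F R\<^esub> z =
      x \<otimes>\<^bsub>ultraproduct F R\<^esub> z \<oplus>\<^bsub>ultraproduct F R\<^esub> y \<otimes>\<^bsub>ultraproduct F R\<^esub> z"
    and "z \<otimes>\<^bsub>ultraproduct F R\<^esub> (x \<oplus>\<^bsub>ultraproduct F R\<^esub> y) =
      z \<otimes>\<^bsub>ultraproduct F R\<^esub> x \<oplus>\<^bsub>ultraproduct F R\<^esub> z \<otimes>\<^bsub>ultraproduct F R\<^esub> y"
    by (elim ultraproduct_cases; simp add: simps)+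
qed

text \<open>Negation is not a field of the ring record but is derived from addition, so it is
  identified through uniqueness of additive inverses.\<close>

lemma neg_ultraproduct:
  assumes "f \<in> prod_carrier"
  shows "\<ominus>\<^bsub>ultraproduct F R\<^esub> ultra_class F R f = ultra_class F R (\<lambda>i. \<ominus>\<^bsub>R i\<^esub> f i)"
proof (rule abelian_group.minus_equality)
  show "abelian_group (ultraproduct F R)"
    using ring_ultraproduct by (rule ring.is_abelian_group)
  have "(\<lambda>i. \<ominus>\<^bsub>R i\<^esub> f i \<oplus>\<^bsub>R i\<^esub> f i) = (\<lambda>i. \<zero>\<^bsub>R i\<^esub>)"
    using assms by (auto intro!: ring.ring_simprules(9)[OF ring_component])
  then show "ultra_class F R (\<lambda>i. \<ominus>\<^bsub>R i\<^esub> f i) \<oplus>\<^bsub>ultraproduct F R\<^esub> ultra_class F R f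
      = \<zero>\<^bsub>ultraproduct F R\<^esub>"
    using assms by (simp add: add_ultraproduct zero_ultraproduct neg_prod_closed)
qed (use assms in \<open>simp_all add: ultra_class_closed neg_prod_closed\<close>)

section \<open>Los's theorem\<close>

lemma term_val_prod_closed:
  assumes "\<And>x. w x \<in> prod_carrier"
  shows "(\<lambda>i. term_val (R i) (\<lambda>x. w x i) t) \<in> prod_carrier"
  by (induction t) (use assms in \<open>simp_all only: term_val.simps prod_closed\<close>)

lemma term_val_ultraproduct:
  assumes "\<And>x. w x \<in> prod_carrier"
  shows "term_val (ultraproduct F R) (\<lambda>x. ultra_class F R (w x)) t
         = ultra_class F R (\<lambda>i. term_val (R i) (\<lambda>x. w x i) t)"
  by (induction t)
    (simp_all add: zero_ultraproduct one_ultraproduct add_ultraproduct mult_ultraproduct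
      neg_ultraproduct term_val_prod_closed[OF assms])

text \<open>Induction on the formula: negation uses that \<open>F\<close> is an ultrafilter,
  conjunction that filters are closed under intersection, and the existential quantifier a choice of
  witnesses index by index.\<close>

theorem sat_ultraproduct_iff:
  assumes "ultrafilter F" and "\<And>x. w x \<in> prod_carrier"
  shows "sat (ultraproduct F R) (\<lambda>x. ultra_class F R (w x)) \<phi>
         \<longleftrightarrow> eventually (\<lambda>i. sat (R i) (\<lambda>x. w x i) \<phi>) F"
  using assms(2)
proof (induction \<phi> arbitrary: w)
  case (FEq s t)
  then show ?case
    by (simp add: term_val_ultraproduct ultra_class_eq_iff term_val_prod_closed)
next
  case (FNot \<phi>)
  then show ?case
    by (simp add: ultrafilter_eventually_not[OF assms(1)])
next
  case (FAnd \<phi> \<psi>)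
  then show ?case
    by (simp add: eventually_conj_iff)
next
  case (FEx x \<phi>)
  \<comment> \<open>Updating a valuation by a class amounts to updating the family of
    representatives, which puts the goal in the form of the induction hypothesis for
    \<open>w(x := f)\<close>.\<close>
  have upd: "sat (ultraproduct F R) ((\<lambda>y. ultra_class F R (w y))(x := ultra_class F R f)) \<phi>
      \<longleftrightarrow> eventually (\<lambda>i. sat (R i) ((\<lambda>y. w y i)(x := f i)) \<phi>) F" if "f \<in> prod_carrier" for f
  proof -
    have "(\<lambda>y. ultra_class F R (w y))(x := ultra_class F R f) = (\<lambda>y. ultra_class F R ((w(x := f)) y))"
      and "(\<lambda>y. w y i)(x := f i) = (\<lambda>y. (w(x := f)) y i)" for i
      by (simp_all add: fun_eq_iff)
    then show ?thesis
      using FEx.IH[of "w(x := f)"] FEx.prems that by simp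
  qed
  have "sat (ultraproduct F R) (\<lambda>y. ultra_class F R (w y)) (FEx x \<phi>)
      \<longleftrightarrow> (\<exists>f\<in>prod_carrier. eventually (\<lambda>i. sat (R i) ((\<lambda>y. w y i)(x := f i)) \<phi>) F)"
    by (simp add: carrier_ultraproduct upd del: fun_upd_apply)
  also have "\<dots> \<longleftrightarrow> eventually (\<lambda>i. \<exists>a\<in>carrier (R i). sat (R i) ((\<lambda>y. w y i)(x := a)) \<phi>) F"
    (is "_ \<longleftrightarrow> eventually ?E F")
  proof
    assume "eventually ?E F"
    \<comment> \<open>A witness is chosen at each index that has one; the default zero elsewhere
      keeps \<open>f\<close> in the product.\<close>
    define f where
      "f i = (if ?E i then SOME a. a \<in> carrier (R i) \<and> sat (R i) ((\<lambda>y. w y i)(x := a)) \<phi> else \<zero>\<^bsub>R i\<^esub>)" for i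
    have f: "f i \<in> carrier (R i) \<and> sat (R i) ((\<lambda>y. w y i)(x := f i)) \<phi>" if "?E i" for i
    proof -
      from that have "\<exists>a. a \<in> carrier (R i) \<and> sat (R i) ((\<lambda>y. w y i)(x := a)) \<phi>" by blast
      from someI_ex[OF this] show ?thesis using that by (simp only: f_def if_True)
    qed
    have "f i \<in> carrier (R i)" for i
      using f[of i] ring.ring_simprules(2)[OF ring_component, of i] by (cases "?E i") (auto simp: f_def)
    moreover have "eventually (\<lambda>i. sat (R i) ((\<lambda>y. w y i)(x := f i)) \<phi>) F"
      using \<open>eventually ?E F\<close> by (rule eventually_mono) (use f in blast)
    ultimately show "\<exists>f\<in>prod_carrier. eventually (\<lambda>i. sat (R i) ((\<lambda>y. w y i)(x := f i)) \<phi>) F"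
      by blast
  qed (auto elim!: eventually_mono)
  finally show ?case by simp
qed

lemma valuation_lift:
  assumes "range v \<subseteq> carrier (ultraproduct F R)"
  obtains w where "\<And>x. w x \<in> prod_carrier" "v = (\<lambda>x. ultra_class F R (w x))"
proof -
  have "\<forall>x. \<exists>f. f \<in> prod_carrier \<and> v x = ultra_class F R f"
    using assms unfolding carrier_ultraproduct by blast
  then show ?thesis
    using that by (metis ext)
qed

end

section \<open>Congruences in quotients of the integers\<close>

lemma ZFact_ZMod:
  shows carrier_ZFact: "carrier (ZFact k) = range (ZMod k)"
    and add_ZFact: "ZMod k a \<oplus>\<^bsub>ZFact k\<^esub> ZMod k b = ZMod k (a + b)"
    and mult_ZFact: "ZMod k a \<otimes>\<^bsub>ZFact k\<^esub> ZMod k b = ZMod k (a * b)"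
proof -
  interpret ideal "Idl\<^bsub>\<Z>\<^esub> {k}" \<Z>
    by (rule int.genideal_ideal) fast
  show "carrier (ZFact k) = range (ZMod k)"
    by (auto simp: ZFact_def FactRing_def A_RCOSETS_defs ZMod_def[abs_def] a_r_coset_def)
  show "ZMod k a \<oplus>\<^bsub>ZFact k\<^esub> ZMod k b = ZMod k (a + b)"
    using a_rcos_sum[of a b] by (simp add: ZFact_def FactRing_def ZMod_def)
  show "ZMod k a \<otimes>\<^bsub>ZFact k\<^esub> ZMod k b = ZMod k (a * b)"
    using rcoset_mult_add[of a b] by (simp add: ZFact_def FactRing_def ZMod_def)
qed

lemma ring_ZFact: "ring (ZFact k)"
  by (rule cring.axioms(1)[OF ZFact_is_cring])

text \<open>Expresses that variable 0 is congruent to variable \<open>y\<close> modulo variable 1,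
  with the bound variable 3 as cofactor. The TP2 formula is the instance \<open>y = 2\<close>; the
  instance \<open>y = 4\<close> allows two congruences with the same unknown and modulus to be
  conjoined.\<close>

definition cong_form :: "nat \<Rightarrow> rform" where
  "cong_form y = FEx 3 (FEq (RVar 0) (RAdd (RVar y) (RMul (RVar 1) (RVar 3))))"

text \<open>Since \<open>p\<close> divides \<open>k\<close>, a multiple of \<open>k\<close> does not
  change a residue modulo \<open>p\<close>, so solvability in the quotient is the integer
  congruence. The condition \<open>y \<noteq> 3\<close> avoids capture by the quantifier.\<close>

lemma sat_cong_form_ZFact:
  assumes "v 0 = ZMod k a" "v 1 = ZMod k p" "v y = ZMod k j" "y \<noteq> 3" "p dvd k"
  shows "sat (ZFact k) v (cong_form y) \<longleftrightarrow> [a = j] (mod p)"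
proof -
  have "sat (ZFact k) v (cong_form y) \<longleftrightarrow> (\<exists>z. k dvd a - (j + p * z))"
    using assms by (simp add: cong_form_def carrier_ZFact add_ZFact mult_ZFact ZMod_eq_mod mod_eq_dvd_iff)
  also have "\<dots> \<longleftrightarrow> p dvd a - j"
  proof
    assume "\<exists>z. k dvd a - (j + p * z)"
    then obtain z where "k dvd a - (j + p * z)" ..
    with \<open>p dvd k\<close> have "p dvd (a - (j + p * z)) + p * z"
      by (intro dvd_add) (auto intro: dvd_trans)
    then show "p dvd a - j" by simp
  next
    assume "p dvd a - j"
    then obtain z where "a - j = p * z" ..
    then have "a - (j + p * z) = 0" by simp
    then show "\<exists>z. k dvd a - (j + p * z)" by (metis dvd_0_right)
  qed
  finally show ?thesis by (simp add: cong_iff_dvd_diff)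
qed

text \<open>At most \<open>k\<close> of the given primes lie below \<open>k\<close>, so at least
  \<open>k\<close> remain. The bound \<open>k \<le> p i\<close> later separates the residues below
  \<open>k\<close>.\<close>

lemma large_distinct_prime_divisors:
  fixes P :: "nat set"
  assumes "finite P" "2 * k \<le> card P" "\<forall>p\<in>P. prime p \<and> p dvd m"
  shows "\<exists>p. inj_on p {..<k} \<and> (\<forall>i<k. prime (p i) \<and> p i dvd m \<and> k \<le> p i)"
proof -
  have "k \<le> card (P - {..<k})"
    using diff_card_le_card_Diff[of "{..<k}" P] assms(2) by simp
  then obtain Q where Q: "Q \<subseteq> P - {..<k}" "card Q = k" "finite Q"
    by (metis obtain_subset_with_card_n)
  then obtain p where "bij_betw p {0..<k} Q"
    using ex_bij_betw_nat_finite by blast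
  then have "inj_on p {..<k}" "\<And>i. i < k \<Longrightarrow> p i \<in> Q"
    by (auto simp: bij_betw_def atLeast0LessThan)
  moreover have "prime q \<and> q dvd m \<and> k \<le> q" if "q \<in> Q" for q
    using Q(1) assms(3) that not_le by blast
  ultimately show ?thesis by blast
qed

section \<open>The tree property\<close>

lemma consistent_if_realised:
  assumes "ring M" "length as = k" "set as \<subseteq> carrier M"
    and "\<And>\<phi> bs. (\<phi>, bs) \<in> \<Gamma> \<Longrightarrow> sat M (assign M (as @ bs)) \<phi>"
  shows "consistent k M \<Gamma>"
proof -
  have "elementary_embedding id M M"
    by (simp add: elementary_embedding_def)
  with assms show ?thesis
    unfolding consistent_def by (intro exI[of _ M] exI[of _ id] exI[of _ as]) auto
qed

text \<open>Consistency ranges over all elementary extensions. That two congruences have a common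
  solution is a single first-order formula with parameters in \<open>M\<close>, so its failure in
  \<open>M\<close> passes to every extension.\<close>

lemma inconsistent_cong_forms:
  fixes M :: "'a ring"
  assumes "{p, c, d} \<subseteq> carrier M"
    and "\<not> sat M ((\<lambda>_. c)(1 := p, 4 := d)) (FEx 0 (FAnd (cong_form 2) (cong_form 4)))"
    and "{(cong_form 2, [p, c]), (cong_form 2, [p, d])} \<subseteq> \<Gamma>"
  shows "\<not> consistent 1 M \<Gamma>"
proof
  \<comment> \<open>The default value \<open>c\<close> serves as the residue at variable 2 and keeps
    the whole valuation inside \<open>M\<close>.\<close>
  let ?v = "(\<lambda>_ :: nat. c)(1 := p, 4 := d)" and ?\<psi> = "FEx 0 (FAnd (cong_form 2) (cong_form 4))"
  assume "consistent 1 M \<Gamma>"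
  then obtain N :: "'a ring" and h as where h: "elementary_embedding h M N"
    and as: "length as = 1" "set as \<subseteq> carrier N"
    and sat: "\<And>\<phi> bs. (\<phi>, bs) \<in> \<Gamma> \<Longrightarrow> sat N (assign N (as @ map h bs)) \<phi>"
    unfolding consistent_def by blast
  obtain a where a: "as = [a]" "a \<in> carrier N"
    using as by (auto simp: length_Suc_conv)
  have "sat N (assign N [a, h p, h c]) (cong_form 2)" "sat N (assign N [a, h p, h d]) (cong_form 2)"
    using sat[of "cong_form 2" "[p, c]"] sat[of "cong_form 2" "[p, d]"] assms(3) a(1) by auto
  \<comment> \<open>The realisation \<open>a\<close> witnesses the outer quantifier; the second
    residue moves from variable 2 to variable 4.\<close>
  then have "sat N (h \<circ> ?v) ?\<psi>"
    using a(2) by (auto simp: cong_form_def assign_def)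
  moreover have "range ?v \<subseteq> carrier M"
    using assms(1) by auto
  ultimately show False
    using h assms(2) unfolding elementary_embedding_def by blast
qed

text \<open>The sequence \<open>c\<close> covers both uses: the identity for a free ultrafilter, and
  the constant 0, which gives an ultrapower of the integers. \<open>T\<close> may be any part of the
  theory of the ultraproduct, for which the latter is then a model.\<close>

lemma theory_TP2_ultraproduct_ZFact:
  fixes V :: "nat filter" and c :: "nat \<Rightarrow> nat"
  assumes V: "ultrafilter V" "V \<le> sequentially"
    and divisors: "\<And>b :: nat. eventually
           (\<lambda>n. \<exists>P :: nat set. finite P \<and> b \<le> card P \<and> (\<forall>p\<in>P. prime p \<and> p dvd c n)) V"
    and T: "T \<subseteq> ring_theory (ultraproduct V (\<lambda>n. ZFact (int (c n))))"
  shows "theory_TP2 TYPE((nat \<Rightarrow> int set) set) T"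
proof -
  let ?R = "\<lambda>n. ZFact (int (c n))"
  let ?M = "ultraproduct V ?R"
  interpret ring_family V ?R
    by (rule ring_family.intro) (rule ring_ZFact)
  define many where "many b n \<longleftrightarrow>
    (\<exists>P :: nat set. finite P \<and> b \<le> card P \<and> (\<forall>p\<in>P. prime p \<and> p dvd c n))" for b n
  \<comment> \<open>The cap \<open>k \<le> n\<close> keeps the maximum finite even when
    \<open>c n = 0\<close>; it does not stop \<open>K\<close> from tending to infinity, because
    \<open>V\<close> is free.\<close>
  define K where "K n = Max {k. k \<le> n \<and> many (2 * k) n}" for n
  have K_fin: "finite {k. k \<le> n \<and> many (2 * k) n}" for n
    by (rule finite_subset[of _ "{..n}"]) auto
  have "many 0 n" for n
    unfolding many_def by (rule exI[of _ "{}"]) simp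
  then have "0 \<in> {k. k \<le> n \<and> many (2 * k) n}" for n
    by simp
  then have K_many: "many (2 * K n) n" for n
    using Max_in[OF K_fin, of n] unfolding K_def by blast
  have K_large: "eventually (\<lambda>n. k \<le> K n) V" for k
  proof -
    have "eventually (\<lambda>n. k \<le> n) V"
      using filter_leD[OF V(2) eventually_ge_at_top] .
    moreover have "eventually (many (2 * k)) V"
      using divisors[of "2 * k"] by (simp add: many_def[abs_def])
    ultimately show ?thesis
      by (rule eventually_elim2) (auto simp: K_def intro!: Max_ge K_fin)
  qed
  have "\<forall>n. \<exists>p. inj_on p {..<K n} \<and> (\<forall>i<K n. prime (p i) \<and> p i dvd c n \<and> K n \<le> p i)"
    using K_many large_distinct_prime_divisors unfolding many_def by blast
  \<comment> \<open>For \<open>i \<ge> K n\<close> the value \<open>p n i\<close> is arbitrary. For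
    fixed \<open>i\<close> this happens only outside a set of \<open>V\<close>, by
    \<open>K_large\<close>.\<close>
  then obtain p where p_inj: "\<And>n. inj_on (p n) {..<K n}"
    and p: "\<And>n i. i < K n \<Longrightarrow> prime (p n i) \<and> p n i dvd c n \<and> K n \<le> p n i"
    by metis
  define lift where "lift f = ultra_class V ?R (\<lambda>n. ZMod (int (c n)) (int (f n)))" for f
  have lift_prod: "(\<lambda>n. ZMod (int (c n)) (f n)) \<in> prod_carrier" for f
    by (auto simp: carrier_ZFact)
  have lift_closed: "lift f \<in> carrier ?M" for f
    unfolding lift_def by (intro ultra_class_closed lift_prod)
  define b where "b i j = [lift (\<lambda>n. p n i), lift (\<lambda>_. j)]" for i j :: nat

  have rows: "\<not> consistent 1 ?M {(cong_form 2, b i j) | j. j \<in> J}" if J: "card J = 2" for i J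
  proof -
    obtain j j' where jj: "J = {j, j'}" "j \<noteq> j'"
      using J by (auto simp: card_2_iff)
    let ?w = "(\<lambda>(_ :: nat) n. ZMod (int (c n)) (int j))
      (1 := \<lambda>n. ZMod (int (c n)) (int (p n i)), 4 := \<lambda>n. ZMod (int (c n)) (int j'))"
    let ?\<psi> = "FEx 0 (FAnd (cong_form 2) (cong_form 4))"
    \<comment> \<open>The bound on \<open>K n\<close> gives \<open>i < K n\<close>, so that
      \<open>p n i\<close> is one of the chosen prime divisors, and also
      \<open>j, j' < K n \<le> p n i\<close>, so that the two residues are distinct.\<close>
    have unsat: "\<not> sat (?R n) (\<lambda>x. ?w x n) ?\<psi>" if n: "Suc (i + j + j') \<le> K n" for n
    proof
      assume "sat (?R n) (\<lambda>x. ?w x n) ?\<psi>"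
      then obtain a where a: "sat (?R n) ((\<lambda>x. ?w x n)(0 := ZMod (int (c n)) a)) (cong_form 2)"
          "sat (?R n) ((\<lambda>x. ?w x n)(0 := ZMod (int (c n)) a)) (cong_form 4)"
        by (auto simp: carrier_ZFact)
      have p': "p n i dvd c n" "K n \<le> p n i"
        using p[of i n] n by auto
      then have "[a = int j] (mod int (p n i))" "[a = int j'] (mod int (p n i))"
        using a by (simp_all add: sat_cong_form_ZFact)
      then have "[j = j'] (mod p n i)"
        by (metis cong_int_iff cong_sym cong_trans)
      then show False
        using jj(2) n p'(2) by (auto simp: cong_def)
    qed
    have "eventually (\<lambda>n. \<not> sat (?R n) (\<lambda>x. ?w x n) ?\<psi>) V"
      using K_large by (rule eventually_mono) (rule unsat)
    moreover have "?w x \<in> prod_carrier" for x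
      using lift_prod by simp
    ultimately have "\<not> sat ?M (\<lambda>x. ultra_class V ?R (?w x)) ?\<psi>"
      using sat_ultraproduct_iff[OF V(1), of ?w ?\<psi>] ultrafilter_eventually_not[OF V(1)] by blast
    moreover have "(\<lambda>x. ultra_class V ?R (?w x))
        = (\<lambda>_. lift (\<lambda>_. j))(1 := lift (\<lambda>n. p n i), 4 := lift (\<lambda>_. j'))"
      by (auto simp: lift_def fun_eq_iff)
    ultimately have "\<not> sat ?M
        ((\<lambda>_. lift (\<lambda>_. j))(1 := lift (\<lambda>n. p n i), 4 := lift (\<lambda>_. j'))) ?\<psi>"
      by (simp only: not_False_eq_True)
    then show ?thesis
      by (rule inconsistent_cong_forms[rotated]) (auto simp: lift_closed jj(1) b_def)
  qed

  have branches: "consistent 1 ?M {(cong_form 2, b i (\<xi> i)) | i. True}" for \<xi>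
  proof -
    \<comment> \<open>Coordinate \<open>n\<close> solves only the first \<open>K n\<close>
      congruences of the branch. Each fixed \<open>i\<close> is eventually among them, so the single
      class \<open>lift a\<close> satisfies all infinitely many; this diagonal choice takes the
      place of saturation.\<close>
    have "\<exists>a. \<forall>i\<in>{..<K n}. [a = \<xi> i] (mod p n i)" for n
    proof (rule chinese_remainder_nat)
      show "\<forall>i\<in>{..<K n}. \<forall>j\<in>{..<K n}. i \<noteq> j \<longrightarrow> coprime (p n i) (p n j)"
        using p p_inj[of n] by (auto intro!: primes_coprime dest: inj_onD)
    qed simp
    then obtain a where a: "\<And>n i. i < K n \<Longrightarrow> [a n = \<xi> i] (mod p n i)"
      by (metis lessThan_iff)
    have realised: "sat ?M (assign ?M ([lift a] @ b i (\<xi> i))) (cong_form 2)" for i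
    proof -
      \<comment> \<open>The default zero matches the value of \<open>assign\<close> outside its
        tuple, so the two valuations agree at every variable.\<close>
      let ?w = "(\<lambda>(_ :: nat) n. \<zero>\<^bsub>?R n\<^esub>)(0 := \<lambda>n. ZMod (int (c n)) (int (a n)),
        1 := \<lambda>n. ZMod (int (c n)) (int (p n i)), 2 := \<lambda>n. ZMod (int (c n)) (int (\<xi> i)))"
      have "sat (?R n) (\<lambda>x. ?w x n) (cong_form 2)" if "Suc i \<le> K n" for n
        using that p[of i n] a[of i n]
        by (subst sat_cong_form_ZFact[where a = "int (a n)" and p = "int (p n i)" and j = "int (\<xi> i)"])
          (auto simp: cong_int_iff)
      then have "eventually (\<lambda>n. sat (?R n) (\<lambda>x. ?w x n) (cong_form 2)) V"
        using K_large[of "Suc i"] by (auto elim: eventually_mono)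
      moreover have "?w x \<in> prod_carrier" for x
        using lift_prod zero_prod_closed by simp
      ultimately have "sat ?M (\<lambda>x. ultra_class V ?R (?w x)) (cong_form 2)"
        using sat_ultraproduct_iff[OF V(1), of ?w "cong_form 2"] by blast
      moreover have "(\<lambda>x. ultra_class V ?R (?w x)) = assign ?M ([lift a] @ b i (\<xi> i))"
        by (auto simp: fun_eq_iff assign_def b_def lift_def zero_ultraproduct nth_Cons' less_Suc_eq numeral_2_eq_2)
      ultimately show ?thesis by simp
    qed
    show ?thesis
      by (rule consistent_if_realised[OF ring_ultraproduct, of "[lift a]"])
        (use realised lift_closed in auto)
  qed

  have "formula_TP2 TYPE((nat \<Rightarrow> int set) set) T 1 2 (cong_form 2)"
    unfolding formula_TP2_def
  proof (rule exI[of _ ?M], rule exI[of _ b], rule exI[of _ 2], intro conjI allI impI)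
    show "is_model ?M T"
      using T by (simp add: is_model_def ring_ultraproduct)
    show "length (b i j) = 2" "set (b i j) \<subseteq> carrier ?M" for i j
      by (auto simp: b_def lift_closed)
    show "\<not> consistent 1 ?M {(cong_form 2, b i j) | j. j \<in> J}" if "finite J \<and> card J = 2" for i J
      using rows that by blast
    show "consistent 1 ?M {(cong_form 2, b i (\<xi> i)) | i. True}" for \<xi>
      by (rule branches)
  qed
  moreover have "free_vars (cong_form 2) \<subseteq> {..<1 + 2}"
    by (auto simp: cong_form_def)
  ultimately show ?thesis
    unfolding theory_TP2_def by blast
qed

text \<open>A principal ultrafilter at \<open>0\<close> satisfies the hypothesis, since every prime divides \<open>0\<close>.
  The ultraproduct is then \<open>\<int>\<close>, and the array of parameters lives in a free ultrapower of it.\<close>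

lemma ring_theory_ultraproduct_principal:
  assumes U: "ultrafilter U" "eventually (\<lambda>i. i = k) U" and V: "ultrafilter V"
    and R: "\<And>i. ring (R i)"
  shows "ring_theory (ultraproduct U R) \<subseteq> ring_theory (ultraproduct V (\<lambda>_. R k))"
proof
  interpret U: ring_family U R by (rule ring_family.intro) (rule R)
  interpret V: ring_family V "\<lambda>_. R k" by (rule ring_family.intro) (rule R)
  fix \<phi> assume \<phi>: "\<phi> \<in> ring_theory (ultraproduct U R)"
  have sat_k: "sat (R k) u \<phi>" if u: "\<And>x. u x \<in> carrier (R k)" for u
  proof -
    \<comment> \<open>A valuation of \<open>R k\<close> is extended by zero to the product. As
      \<open>U\<close> concentrates on \<open>k\<close>, Los's theorem reads off truth at coordinate
      \<open>k\<close>.\<close>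
    let ?w = "\<lambda>x i. if i = k then u x else \<zero>\<^bsub>R i\<^esub>"
    have w: "?w x \<in> U.prod_carrier" for x
      using u U.zero_prod_closed by auto
    have "range (\<lambda>x. ultra_class U R (?w x)) \<subseteq> carrier (ultraproduct U R)"
      by (intro image_subsetI U.ultra_class_closed w)
    then have "sat (ultraproduct U R) (\<lambda>x. ultra_class U R (?w x)) \<phi>"
      using \<phi> by (simp add: ring_theory_def)
    then have "eventually (\<lambda>i. sat (R i) (\<lambda>x. ?w x i) \<phi>) U"
      by (subst (asm) U.sat_ultraproduct_iff[OF U(1)]) (rule w)
    with U(2) have "eventually (\<lambda>i. i = k \<and> sat (R i) (\<lambda>x. ?w x i) \<phi>) U"
      by (rule eventually_conj)
    moreover have "U \<noteq> bot"
      using U(1) by (simp add: ultrafilter_def)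
    ultimately obtain i where "i = k" "sat (R i) (\<lambda>x. ?w x i) \<phi>"
      using eventually_happens' by blast
    then show ?thesis by simp
  qed
  have "sat (ultraproduct V (\<lambda>_. R k)) v \<phi>"
    if v: "range v \<subseteq> carrier (ultraproduct V (\<lambda>_. R k))" for v
  proof -
    obtain w where w: "\<And>x. w x \<in> V.prod_carrier" "v = (\<lambda>x. ultra_class V (\<lambda>_. R k) (w x))"
      using V.valuation_lift[OF v] by metis
    have "sat (R k) (\<lambda>x. w x i) \<phi>" for i
      using w(1) by (intro sat_k) auto
    then show ?thesis
      using V.sat_ultraproduct_iff[OF V w(1)] w(2) by simp
  qed
  then show "\<phi> \<in> ring_theory (ultraproduct V (\<lambda>_. R k))"
    using \<phi> by (simp add: ring_theory_def)
qed

section \<open>Case distinction on whether the ultrafilter concentrates on 0\<close>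

theorem theorem1p4:
  fixes U :: "nat filter"
  assumes "ultrafilter U"
    and "\<And>b :: nat. eventually
           (\<lambda>n. \<exists>P :: nat set. finite P \<and> b \<le> card P \<and> (\<forall>p\<in>P. prime p \<and> p dvd n)) U"
  shows "theory_TP2 TYPE((nat \<Rightarrow> int set) set)
           (ring_theory (ultraproduct U (\<lambda>n. ZFact (int n))))"
proof (cases "eventually (\<lambda>n. n = 0) U")
  case True
  obtain V :: "nat filter" where V: "V \<le> sequentially" "ultrafilter V"
    using ultrafilter_le_exists[of sequentially] by auto
  have "\<exists>P :: nat set. finite P \<and> b \<le> card P \<and> (\<forall>p\<in>P. prime p \<and> p dvd 0)" for b :: nat
  proof -
    obtain P :: "nat set" where "finite P" "card P = b" "P \<subseteq> {p. prime p}"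
      using infinite_arbitrarily_large[OF primes_infinite] by blast
    then show ?thesis by (intro exI[of _ P]) auto
  qed
  then show ?thesis
    using ring_theory_ultraproduct_principal[OF assms(1) True V(2), of "\<lambda>n. ZFact (int n)"]
    by (intro theory_TP2_ultraproduct_ZFact[OF V(2,1), of "\<lambda>_. 0"])
      (simp_all add: ring_ZFact)
next
  case False
  then have nz: "eventually (\<lambda>n. n \<noteq> 0) U"
    by (subst ultrafilter_eventually_not[OF assms(1)])
  \<comment> \<open>A nonzero \<open>n\<close> has all its prime divisors in \<open>{1..n}\<close>,
    so \<open>b\<close> distinct ones force \<open>b \<le> n\<close>. Hence \<open>U\<close>
    contains every tail and is free.\<close>
  have "eventually (\<lambda>n. b \<le> n) U" for b
    using assms(2)[of b] nz
  proof (rule eventually_elim2)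
    fix n :: nat
    assume "\<exists>P :: nat set. finite P \<and> b \<le> card P \<and> (\<forall>p\<in>P. prime p \<and> p dvd n)" and "n \<noteq> 0"
    then obtain P :: "nat set" where P: "b \<le> card P" "\<forall>p\<in>P. prime p \<and> p dvd n" by blast
    then have "P \<subseteq> {1..n}"
      using \<open>n \<noteq> 0\<close> by (meson atLeastAtMost_iff dvd_imp_le gr0I prime_ge_1_nat subsetI)
    then show "b \<le> n"
      using P(1) card_mono[of "{1..n}" P] by simp
  qed
  then have "U \<le> sequentially"
    unfolding le_filter_def eventually_sequentially by (blast intro: eventually_mono)
  then show ?thesis
    using assms by (intro theory_TP2_ultraproduct_ZFact[of U "\<lambda>n. n"]) auto
qed

end
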